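(* Let $1\le m\le N$, let $z_1,\ldots,z_m$ and $\alpha_m,\ldots,\alpha_{N-1}$ be two collections of arbitrary complex numbers from the open unit disk (not necessarily distinct), and let $\alpha_N\in\mathbb{C}$ with $|\alpha_N|=1$. Then there exists an $N\times N$ truncated CMV matrix $\mathcal{T}$ such that (i) $z_1,\ldots,z_m$ are eigenvalues of $\mathcal{T}$, counting the algebraic multiplicity; (ii) $\alpha_n(\mathcal{T})=\alpha_n$ for $n=m,m+1,\ldots,N$.
   Context: $\mathbb{D}$ is the open unit disk. An $N\times N$ truncated CMV matrix is determined by numbers $\alpha_0,\dots,\alpha_{N-1}\in\mathbb{D}$ and $|\alpha_N|=1$; with $\rho_n=\sqrt{1-|\alpha_n|^2}$, $\mathcal{T}=\mathcal{T}(\{\alpha_n\}_{n=0}^N)=(t_{ij})_{i,j=1}^N$ has entries $t_{k,k}=-\bar\alpha_k\alpha_{k-1}$; for $k$ odd: $t_{k+1,k}=\bar\alpha_{k+1}\rho_k$, $t_{k,k+1}=-\alpha_{k-1}\rho_k$, $t_{k+2,k}=\rho_k\rho_{k+1}$, $t_{k,k+2}=0$; for $k$ even: $t_{k+1,k}=-\alpha_{k-1}\rho_k$, $t_{k,k+1}=\bar\alpha_{k+1}\rho_k$, $t_{k+2,k}=0$, $t_{k,k+2}=\rho_k\rho_{k+1}$ (whenever the indices are $\le N$); all other entries are $0$. The numbers $\alpha_n=\alpha_n(\mathcal{T})$, $n=0,\dots,N$, are called the parameters of $\mathcal{T}$. "Counting the algebraic multiplicity" in (i) means that a value repeated $p$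 times among $z_1,\dots,z_m$ is an eigenvalue of algebraic multiplicity at least $p$. *)

theory Defs
  imports "Jordan_Normal_Form.Char_Poly" "HOL.Complex"
begin

definition cmv_rho :: "(nat \<Rightarrow> complex) \<Rightarrow> nat \<Rightarrow> complex" where
  "cmv_rho \<alpha> n = complex_of_real (sqrt (1 - (cmod (\<alpha> n))\<^sup>2))"

(* The entry t_{i,j}, with i and j starting from 1. *)
definition cmv_entry :: "(nat \<Rightarrow> complex) \<Rightarrow> nat \<Rightarrow> nat \<Rightarrow> complex" where
  "cmv_entry \<alpha> i j =
    (if i = j then - cnj (\<alpha> j) * \<alpha> (j - 1)
     else if i = j + 1 then
       (if odd j then cnj (\<alpha> (j + 1)) * cmv_rho \<alpha> j else - \<alpha> (j - 1) * cmv_rho \<alpha> j)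
     else if j = i + 1 then
       (if odd i then - \<alpha> (i - 1) * cmv_rho \<alpha> i else cnj (\<alpha> (i + 1)) * cmv_rho \<alpha> i)
     else if i = j + 2 then
       (if odd j then cmv_rho \<alpha> j * cmv_rho \<alpha> (j + 1) else 0)
     else if j = i + 2 then
       (if odd i then 0 else cmv_rho \<alpha> i * cmv_rho \<alpha> (i + 1))
     else 0)"

(* Matrix indices of type mat start from 0, hence the shift. *)
definition cmv_mat :: "nat \<Rightarrow> (nat \<Rightarrow> complex) \<Rightarrow> complex mat" where
  "cmv_mat N \<alpha> = mat N N (\<lambda>(i, j). cmv_entry \<alpha> (i + 1) (j + 1))"

(* The parameters are carried along as a relation rather than recovered as a function of T:
   for N = 1 the matrix only determines the product of alpha_0 and the conjugate of alpha_1.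
   Values of alpha beyond N are irrelevant. *)
definition truncated_CMV :: "nat \<Rightarrow> (nat \<Rightarrow> complex) \<Rightarrow> complex mat \<Rightarrow> bool" where
  "truncated_CMV N \<alpha> T \<longleftrightarrow>
    (\<forall>n<N. cmod (\<alpha> n) < 1) \<and> cmod (\<alpha> N) = 1 \<and> T = cmv_mat N \<alpha>"

definition alg_multiplicity :: "complex mat \<Rightarrow> complex \<Rightarrow> nat" where
  "alg_multiplicity A w = order w (char_poly A)"

end

theory Submission
  imports Defs "HOL-Complex_Analysis.Conformal_Mappings" "HOL-Analysis.Brouwer_Fixpoint"
begin

hide_const (open) module.smult

text \<open>
  The characteristic polynomial of a truncated CMV matrix obeys a Szego recursion. Write
  \<open>F\<^sub>j\<close> for the characteristic polynomial belonging to the parameters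
  \<open>\<alpha>\<^sub>j, \<dots>, \<alpha>\<^sub>N\<close>. Expanding the determinant along its first row gives
  \<open>F\<^sub>j = X F\<^sub>j\<^sub>+\<^sub>1 + \<alpha>\<^sub>j S\<^sub>j\<^sub>+\<^sub>1\<close> and
  \<open>S\<^sub>j = S\<^sub>j\<^sub>+\<^sub>1 + cnj \<alpha>\<^sub>j X F\<^sub>j\<^sub>+\<^sub>1\<close>,
  started from \<open>F\<^sub>N = 1\<close>, \<open>S\<^sub>N = cnj \<alpha>\<^sub>N\<close>
  (\<open>char_poly_cmv_mat_eq_szegoF\<close>). So the given numbers
  \<open>\<alpha>\<^sub>m, \<dots>, \<alpha>\<^sub>N\<close> are the parameters applied first, and the task is to
  continue the recursion by \<open>m\<close> more steps such that the final polynomial vanishes at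
  \<open>m\<close> prescribed points (\<open>prescribed_zeros\<close>).

  This goes by induction on \<open>m\<close>. Suppose that \<open>m\<close> zeros can be prescribed for every
  tail, and let one more zero \<open>x\<close> be given, at the cost of one more free parameter
  \<open>a\<close>. For each \<open>a\<close> in the disk there is a polynomial \<open>F = Q q\<close>, with
  \<open>Q\<close> carrying the first \<open>m\<close> zeros. Let \<open>h a\<close> be the value at \<open>x\<close> of the
  Blaschke product with the zeros of \<open>q\<close>, multiplied by a unimodular constant. If \<open>h\<close> is
  well defined and continuous on the closed disk and the identity on the unit circle, then it
  has a zero, since the circle is not a retract of the disk; and \<open>h a = 0\<close> means that
  \<open>x\<close> is a zero of \<open>q\<close>.

  \<^item> On the circle: for \<open>|a| = 1\<close> the recursion degenerates, everything applied before
    \<open>a\<close> splits off as a common factor, and one computes \<open>h a = a\<close>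
    (\<open>blaschke_value_boundary\<close>).
  \<^item> Well defined: the zeros of \<open>q\<close> are determined by \<open>Q\<close> and the tail
    (\<open>residual_zeros_unique\<close>). For two solutions, the tail fixes the first Taylor
    coefficients of the Caratheodory function of the Bernstein--Szego weight of \<open>F\<close>; the
    difference of the two functions is orthogonal to all trigonometric polynomials of low
    degree, among them the one that makes the pairing an integral of a square.
  \<^item> Continuous: all solutions together form a compact set, whose image under
    \<open>(a, h a)\<close> is the graph of \<open>h\<close>. Compactness is what forces the other
    parameters to be allowed in the closed disk; they never reach the boundary, because there
    the degeneration would leave too few zeros inside the disk
    (\<open>head_parameters_in_disk\<close>).
\<close>

section \<open>The Szego recursion\<close>

definition szego_step :: "complex \<Rightarrow> complex poly \<times> complex poly \<Rightarrow> complex poly \<times> complex poly" where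
  "szego_step a v =
     (pCons 0 (fst v) + smult a (snd v), snd v + smult (cnj a) (pCons 0 (fst v)))"

text \<open>
  The steps are numbered from the outside: \<open>\<beta> (n - 1)\<close> acts first and \<open>\<beta> 0\<close> last, as
  in a truncated CMV matrix, where \<open>\<alpha>\<^sub>0\<close> is the parameter added last.
\<close>

primrec szego ::
  "(nat \<Rightarrow> complex) \<Rightarrow> nat \<Rightarrow> complex poly \<times> complex poly \<Rightarrow> complex poly \<times> complex poly" where
  "szego \<beta> 0 v = v"
| "szego \<beta> (Suc n) v = szego \<beta> n (szego_step (\<beta> n) v)"

definition szegoF :: "(nat \<Rightarrow> complex) \<Rightarrow> nat \<Rightarrow> complex \<Rightarrow> complex poly" where
  "szegoF \<beta> n c = fst (szego \<beta> n (1, [:c:]))"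

definition szegoS :: "(nat \<Rightarrow> complex) \<Rightarrow> nat \<Rightarrow> complex \<Rightarrow> complex poly" where
  "szegoS \<beta> n c = snd (szego \<beta> n (1, [:c:]))"

text \<open>
  Several facts below concern a property, indexed by the number of steps, that every single step
  preserves; this rule saves repeating the induction.
\<close>

lemma szego_invariant:
  assumes "P k v"
    and "\<And>j k v. j < n \<Longrightarrow> P k v \<Longrightarrow> P (Suc k) (szego_step (\<beta> j) v)"
  shows "P (k + n) (szego \<beta> n v)"
  using assms
proof (induction n arbitrary: k v)
  case 0
  then show ?case by simp
next
  case (Suc n)
  have "P (Suc k + n) (szego \<beta> n (szego_step (\<beta> n) v))"
    using Suc.prems by (intro Suc.IH) auto
  then show ?case by simp
qed

lemma szego_add:
  "szego \<beta> (m + k) v = szego \<beta> m (szego (\<lambda>i. \<beta> (m + i)) k v)"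
  by (induction k arbitrary: v) auto

lemma szego_cong:
  "(\<And>j. j < n \<Longrightarrow> \<beta> j = \<gamma> j) \<Longrightarrow> szego \<beta> n v = szego \<gamma> n v"
  by (induction n arbitrary: v) auto

lemma szego_Suc_outer: "szego \<beta> (Suc n) v = szego_step (\<beta> 0) (szego (\<lambda>i. \<beta> (Suc i)) n v)"
  using szego_add[of \<beta> 1 n v] by simp

lemma szego_linear:
  "szego \<beta> n (p * f + q * g, p * s + q * t) =
     (p * fst (szego \<beta> n (f, s)) + q * fst (szego \<beta> n (g, t)),
      p * snd (szego \<beta> n (f, s)) + q * snd (szego \<beta> n (g, t)))"
proof (induction n arbitrary: f g s t)
  case 0
  then show ?case by simp
next
  case (Suc n)
  have "szego_step (\<beta> n) (p * f + q * g, p * s + q * t) =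
      (p * fst (szego_step (\<beta> n) (f, s)) + q * fst (szego_step (\<beta> n) (g, t)),
       p * snd (szego_step (\<beta> n) (f, s)) + q * snd (szego_step (\<beta> n) (g, t)))"
    by (simp add: szego_step_def algebra_simps smult_add_right)
  then show ?case using Suc.IH by simp
qed

lemma szego_smult:
  "szego \<beta> n (p * f, p * s) = (p * fst (szego \<beta> n (f, s)), p * snd (szego \<beta> n (f, s)))"
  using szego_linear[of \<beta> n p f 0 0 s 0] by simp

lemma szego_snd_at_0: "poly (snd (szego \<beta> n v)) 0 = poly (snd v) 0"
  by (induction n arbitrary: v) (auto simp: szego_step_def)

lemma szego_monic:
  "degree (szegoF \<beta> n c) = n" "lead_coeff (szegoF \<beta> n c) = 1"
proof -
  define P where "P = (\<lambda>k (v :: complex poly \<times> complex poly).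
     degree (fst v) = k \<and> lead_coeff (fst v) = 1 \<and> degree (snd v) \<le> k)"
  have "P (0 + n) (szego \<beta> n (1, [:c:]))"
  proof (rule szego_invariant)
    show "P 0 (1, [:c:])" by (simp add: P_def)
  next
    fix j k v
    assume v: "P k v"
    then have f0: "fst v \<noteq> 0" by (auto simp: P_def)
    then have d: "degree (pCons 0 (fst v)) = Suc k"
      using v by (simp add: P_def)
    have ds: "degree (smult (\<beta> j) (snd v)) < Suc k"
      using v by (auto simp: P_def intro: le_less_trans[OF degree_smult_le])
    have "degree (fst (szego_step (\<beta> j) v)) = Suc k"
      unfolding szego_step_def using d ds by (simp add: degree_add_eq_left)
    moreover have "coeff (fst (szego_step (\<beta> j) v)) (Suc k) = 1"
      using v ds by (auto simp: szego_step_def P_def coeff_eq_0 split: if_splits)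
    moreover have "degree (snd (szego_step (\<beta> j) v)) \<le> Suc k"
      unfolding szego_step_def snd_conv using v d
      by (intro degree_add_le order.trans[OF degree_smult_le]) (auto simp: P_def)
    ultimately show "P (Suc k) (szego_step (\<beta> j) v)" by (simp add: P_def)
  qed
  then show "degree (szegoF \<beta> n c) = n" "lead_coeff (szegoF \<beta> n c) = 1"
    by (auto simp: P_def szegoF_def)
qed

lemma szegoF_neq_0: "szegoF \<beta> n c \<noteq> 0"
proof
  assume "szegoF \<beta> n c = 0"
  with szego_monic(2)[of \<beta> n c] show False by simp
qed

text \<open>
  A step is multiplication by a matrix with determinant \<open>z (1 - |\<beta>\<^sub>j|\<^sup>2)\<close>.
\<close>

lemma szego_wronskian:
  "poly (fst (szego \<beta> n v)) z * poly (snd (szego \<beta> n w)) z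
     - poly (snd (szego \<beta> n v)) z * poly (fst (szego \<beta> n w)) z
   = z ^ n * of_real (\<Prod>j<n. 1 - (cmod (\<beta> j))\<^sup>2)
     * (poly (fst v) z * poly (snd w) z - poly (snd v) z * poly (fst w) z)"
proof (induction n arbitrary: v w)
  case 0
  then show ?case by simp
next
  case (Suc n)
  have *: "complex_of_real (1 - (cmod a)\<^sup>2) = 1 - a * cnj a" for a
    by (simp add: complex_norm_square[symmetric])
  show ?case
    by (simp add: Suc szego_step_def * del: of_real_diff) (simp add: algebra_simps)
qed

text \<open>
  Up to the constant \<open>c\<close>, the second component is the reversed polynomial of the first;
  restricting to the unit circle turns reversal into complex conjugation.
\<close>

lemma szego_reversed_on_circle:
  assumes "cmod c = 1" "cmod z = 1"
  shows "poly (szegoS \<beta> n c) z = c * z ^ n * cnj (poly (szegoF \<beta> n c) z)"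
proof -
  have zz: "z * cnj z = 1" "c * cnj c = 1"
    using assms by (simp_all add: complex_norm_square[symmetric])
  define P where "P = (\<lambda>k (v :: complex poly \<times> complex poly).
     poly (snd v) z = c * z ^ k * cnj (poly (fst v) z))"
  have "P (0 + n) (szego \<beta> n (1, [:c:]))"
  proof (rule szego_invariant)
    show "P 0 (1, [:c:])" by (simp add: P_def)
  next
    fix j k v
    assume "P k v"
    then have v: "poly (snd v) z = c * z ^ k * cnj (poly (fst v) z)" by (simp add: P_def)
    have "c * z ^ Suc k * cnj (z * poly (fst v) z + \<beta> j * poly (snd v) z)
        = (z * cnj z) * (c * z ^ k * cnj (poly (fst v) z))
          + cnj (\<beta> j) * z * ((c * cnj c) * ((z * cnj z) ^ k * poly (fst v) z))"
      unfolding v by (simp add: algebra_simps power_mult_distrib)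
    then show "P (Suc k) (szego_step (\<beta> j) v)"
      by (simp add: P_def szego_step_def zz v)
  qed
  then show ?thesis by (simp add: P_def szegoF_def szegoS_def)
qed

text \<open>
  Schwarz--Pick for a single step: the disk automorphism \<open>w \<mapsto> (w + a) / (1 + cnj a w)\<close>,
  cleared of denominators so that it survives \<open>|a| = 1\<close>.
\<close>

lemma cmod_moebius_le:
  assumes "cmod x \<le> cmod y" "cmod a \<le> 1"
  shows "cmod (x + a * y) \<le> cmod (y + cnj a * x)"
proof -
  have "(cmod (y + cnj a * x))\<^sup>2 - (cmod (x + a * y))\<^sup>2
      = ((cmod y)\<^sup>2 - (cmod x)\<^sup>2) * (1 - (cmod a)\<^sup>2)"
    unfolding cmod_power2 by (simp add: power2_eq_square algebra_simps)
  moreover have "\<dots> \<ge> 0"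
    using assms by (intro mult_nonneg_nonneg) (auto simp: power_mono abs_square_le_1)
  ultimately have "(cmod (x + a * y))\<^sup>2 \<le> (cmod (y + cnj a * x))\<^sup>2"
    by linarith
  then show ?thesis by (rule power2_le_imp_le) simp
qed

text \<open>
  The quotient of the two components is a Schur function, so the second one dominates the
  first inside the disk. Unimodular parameters are admitted because limits of solutions may
  a priori have them.
\<close>

lemma szegoS_nonzero_inside:
  assumes "\<And>j. j < n \<Longrightarrow> cmod (\<beta> j) \<le> 1" "cmod c = 1" "cmod z < 1"
  shows "poly (szegoS \<beta> n c) z \<noteq> 0"
proof -
  define P where "P = (\<lambda>(k::nat) (v :: complex poly \<times> complex poly).
     poly (snd v) z \<noteq> 0 \<and> cmod (poly (fst v) z) \<le> cmod (poly (snd v) z))"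
  have "P (0 + n) (szego \<beta> n (1, [:c:]))"
  proof (rule szego_invariant)
    show "P 0 (1, [:c:])" using assms by (auto simp: P_def)
  next
    fix j k v
    assume j: "j < n" and v: "P k v"
    let ?f = "poly (fst v) z" and ?s = "poly (snd v) z"
    have "cmod z * cmod ?f \<le> cmod z * cmod ?s"
      using v by (intro mult_left_mono) (auto simp: P_def)
    moreover have "cmod z * cmod ?s < 1 * cmod ?s"
      using v assms(3) by (intro mult_strict_right_mono) (auto simp: P_def)
    ultimately have lt: "cmod (z * ?f) < cmod ?s"
      by (simp add: norm_mult)
    have "cmod (cnj (\<beta> j) * (z * ?f)) \<le> 1 * cmod (z * ?f)"
      unfolding norm_mult[of "cnj (\<beta> j)"] using assms(1)[OF j] by (intro mult_right_mono) auto
    with lt have "?s + cnj (\<beta> j) * (z * ?f) \<noteq> 0"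
      by (metis add.commute add.inverse_unique linorder_not_le mult_1 norm_minus_cancel)
    moreover have "cmod (z * ?f + \<beta> j * ?s) \<le> cmod (?s + cnj (\<beta> j) * (z * ?f))"
      using lt assms(1)[OF j] by (intro cmod_moebius_le) auto
    ultimately show "P (Suc k) (szego_step (\<beta> j) v)"
      by (simp add: P_def szego_step_def mult.left_commute)
  qed
  then show ?thesis by (simp add: P_def szegoS_def)
qed

text \<open>
  Outside the disk the roles are exchanged and the first component dominates: all zeros of the
  orthogonal polynomial lie in the open disk.
\<close>

lemma szegoF_nonzero_outside:
  assumes "\<And>j. j < n \<Longrightarrow> cmod (\<beta> j) < 1" "cmod c = 1" "cmod z \<ge> 1"
  shows "poly (szegoF \<beta> n c) z \<noteq> 0"
proof -
  define P where "P = (\<lambda>(k::nat) (v :: complex poly \<times> complex poly).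
     poly (fst v) z \<noteq> 0 \<and> cmod (poly (snd v) z) \<le> cmod (poly (fst v) z))"
  have "P (0 + n) (szego \<beta> n (1, [:c:]))"
  proof (rule szego_invariant)
    show "P 0 (1, [:c:])" using assms by (auto simp: P_def)
  next
    fix j k v
    assume j: "j < n" and v: "P k v"
    let ?f = "poly (fst v) z" and ?s = "poly (snd v) z"
    have "1 * cmod ?f \<le> cmod z * cmod ?f"
      using assms(3) by (intro mult_right_mono) auto
    then have le: "cmod ?f \<le> cmod (z * ?f)" "cmod ?s \<le> cmod (z * ?f)"
      using v by (auto simp: norm_mult P_def intro: order.trans)
    have "cmod (\<beta> j * ?s) \<le> cmod (\<beta> j) * cmod ?f"
      unfolding norm_mult using v by (intro mult_left_mono) (auto simp: P_def)
    also have "\<dots> < 1 * cmod ?f"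
      using assms(1)[OF j] v by (intro mult_strict_right_mono) (auto simp: P_def)
    finally have "z * ?f + \<beta> j * ?s \<noteq> 0"
      using le by (metis add.inverse_unique linorder_not_le mult_1 norm_minus_cancel)
    moreover have "cmod (?s + cnj (\<beta> j) * (z * ?f)) \<le> cmod (z * ?f + \<beta> j * ?s)"
      using cmod_moebius_le[OF le(2), of "cnj (\<beta> j)"] assms(1)[OF j] by auto
    ultimately show "P (Suc k) (szego_step (\<beta> j) v)"
      by (simp add: P_def szego_step_def mult.left_commute)
  qed
  then show ?thesis by (simp add: P_def szegoF_def)
qed

lemma szegoS_nonzero_cball:
  assumes "\<And>j. j < n \<Longrightarrow> cmod (\<beta> j) < 1" "cmod c = 1" "cmod z \<le> 1"
  shows "poly (szegoS \<beta> n c) z \<noteq> 0"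
proof (cases "cmod z < 1")
  case True
  then show ?thesis using assms by (intro szegoS_nonzero_inside) (auto intro: less_imp_le)
next
  case False
  then have "cmod z = 1" using assms by simp
  moreover from this have "z \<noteq> 0" "c \<noteq> 0" using assms(2) by auto
  ultimately show ?thesis
    using szego_reversed_on_circle[OF assms(2), of z \<beta> n] szegoF_nonzero_outside[of n \<beta> c z] assms
    by auto
qed

text \<open>
  After a unimodular parameter the two components are proportional, and the pair becomes
  \<open>F\<^sub>j (1, cnj \<beta>\<^sub>j)\<close>; what is left is a recursion of length \<open>j\<close>, multiplied by
  the old polynomial \<open>F\<^sub>j\<close>. As \<open>F\<^sub>j = \<beta>\<^sub>j S\<^sub>j\<close>, that factor has no zeros in the disk.
\<close>

lemma szego_unimodular_parameter:
  assumes "\<forall>j<n. cmod (\<beta> j) \<le> 1" "cmod c = 1" "j < n" "cmod (\<beta> j) = 1"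
  shows "\<exists>u. (\<forall>z. cmod z < 1 \<longrightarrow> poly u z \<noteq> 0) \<and>
    szegoF \<beta> n c = u * szegoF \<beta> j (cnj (\<beta> j)) \<and>
    szegoS \<beta> n c = u * szegoS \<beta> j (cnj (\<beta> j))"
proof -
  define v where "v = szego (\<lambda>i. \<beta> (j + i)) (n - j) (1, [:c:])"
  define w where "w = szego (\<lambda>i. \<beta> (j + Suc i)) (n - Suc j) (1, [:c:])"
  have n: "n = j + (n - j)" "n - j = Suc (n - Suc j)" using assms(3) by auto
  have sz: "szego \<beta> n (1, [:c:]) = szego \<beta> j v"
    unfolding v_def by (subst n(1)) (rule szego_add)
  have vw: "v = szego_step (\<beta> j) w"
    unfolding v_def w_def n(2) szego_Suc_outer by simp
  have bb: "\<beta> j * cnj (\<beta> j) = 1"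
    using assms(4) by (simp add: complex_norm_square[symmetric])
  have fv: "fst v = smult (\<beta> j) (snd v)"
    by (simp add: vw szego_step_def smult_add_right bb add.commute)
  have sv: "snd v = smult (cnj (\<beta> j)) (fst v)"
    by (simp add: vw szego_step_def smult_add_right bb add.commute mult.commute[of "cnj (\<beta> j)"])
  have v: "v = (fst v * 1, fst v * [:cnj (\<beta> j):])"
    using sv by (simp add: prod_eq_iff)
  have "szego \<beta> n (1, [:c:]) =
      (fst v * szegoF \<beta> j (cnj (\<beta> j)), fst v * szegoS \<beta> j (cnj (\<beta> j)))"
    unfolding sz szegoF_def szegoS_def by (subst v, subst szego_smult) simp
  moreover have "poly (fst v) z \<noteq> 0" if "cmod z < 1" for z
  proof -
    have "poly (szegoS (\<lambda>i. \<beta> (j + i)) (n - j) c) z \<noteq> 0"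
      using assms that by (intro szegoS_nonzero_inside) auto
    then show ?thesis using assms(4) by (subst fv) (auto simp: v_def szegoS_def)
  qed
  ultimately show ?thesis
    unfolding szegoF_def szegoS_def by (intro exI[of _ "fst v"]) simp
qed

section \<open>Polynomials with prescribed zeros\<close>

lemma poly_eq_if_eq_on_circle:
  fixes p q :: "complex poly"
  assumes "\<And>z. cmod z = 1 \<Longrightarrow> poly p z = poly q z"
  shows "p = q"
proof (rule ccontr)
  assume "p \<noteq> q"
  then have "finite {z. poly (p - q) z = 0}" by (intro poly_roots_finite) simp
  moreover have "sphere 0 1 \<subseteq> {z. poly (p - q) z = 0}" using assms by (auto simp: dist_norm)
  moreover have "infinite (sphere (0::complex) 1)"
  proof
    assume "finite (sphere (0::complex) 1)"
    moreover have "connected (sphere (0::complex) 1)" by (intro connected_sphere) simp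
    ultimately have "sphere (0::complex) 1 = {} \<or> (\<exists>a. sphere (0::complex) 1 = {a})"
      using connected_finite_iff_sing by blast
    moreover have "1 \<in> sphere (0::complex) 1" "-1 \<in> sphere (0::complex) 1" by simp_all
    ultimately have "(1::complex) = -1" by (metis empty_iff singletonD)
    then show False by simp
  qed
  ultimately show False using finite_subset by blast
qed

definition rootpoly :: "nat \<Rightarrow> (nat \<Rightarrow> complex) \<Rightarrow> complex poly" where
  "rootpoly k r = (\<Prod>i<k. [:- r i, 1:])"

definition rootpoly_rev :: "nat \<Rightarrow> (nat \<Rightarrow> complex) \<Rightarrow> complex poly" where
  "rootpoly_rev k r = (\<Prod>i<k. [:1, - cnj (r i):])"

lemma rootpoly_monic [simp]: "degree (rootpoly k r) = k" "lead_coeff (rootpoly k r) = 1"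
proof -
  show "degree (rootpoly k r) = k"
    unfolding rootpoly_def by (subst degree_prod_sum_eq) auto
  show "lead_coeff (rootpoly k r) = 1"
    unfolding rootpoly_def by (simp add: lead_coeff_prod)
qed

lemma coeff_rootpoly_top [simp]: "coeff (rootpoly k r) k = 1"
  using rootpoly_monic(2)[of k r] by simp

lemma rootpoly_nonzero [simp]: "rootpoly k r \<noteq> 0"
  using coeff_rootpoly_top[of k r] by (metis coeff_0 zero_neq_one)

lemma poly_rootpoly: "poly (rootpoly k r) z = (\<Prod>i<k. z - r i)"
  by (simp add: rootpoly_def poly_prod)

lemma poly_rootpoly_eq_0: "poly (rootpoly k r) z = 0 \<longleftrightarrow> (\<exists>i<k. z = r i)"
  by (auto simp: poly_rootpoly)

lemma poly_rootpoly_rev: "poly (rootpoly_rev k r) z = (\<Prod>i<k. 1 - cnj (r i) * z)"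
  by (simp add: rootpoly_rev_def poly_prod mult.commute)

lemma rootpoly_rev_on_circle:
  assumes "cmod z = 1"
  shows "poly (rootpoly_rev k r) z = z ^ k * cnj (poly (rootpoly k r) z)"
proof -
  have "z * cnj z = 1" using assms by (simp add: complex_norm_square[symmetric])
  then have "1 - cnj (r i) * z = z * cnj (z - r i)" for i by (simp add: algebra_simps)
  then show ?thesis by (simp add: poly_rootpoly_rev poly_rootpoly prod.distrib)
qed

lemma rootpoly_rev_nonzero:
  assumes "\<And>i. i < k \<Longrightarrow> cmod (r i) \<le> 1" "cmod z \<le> 1" "cmod z < 1 \<or> (\<forall>i<k. cmod (r i) < 1)"
  shows "poly (rootpoly_rev k r) z \<noteq> 0"
proof -
  have "1 - cnj (r i) * z \<noteq> 0" if "i < k" for i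
  proof
    assume "1 - cnj (r i) * z = 0"
    then have "cmod (cnj (r i) * z) = 1" by (metis eq_iff_diff_eq_0 norm_one)
    then have *: "cmod (r i) * cmod z = 1" by (simp add: norm_mult)
    show False
    proof (cases "cmod z < 1")
      case True
      have "cmod (r i) * cmod z \<le> 1 * cmod z"
        using assms(1)[OF that] by (intro mult_right_mono) auto
      with True * show False by simp
    next
      case False
      then have "cmod (r i) < 1" using assms(3) that by auto
      moreover have "cmod (r i) * cmod z \<le> cmod (r i) * 1"
        using assms(2) by (intro mult_left_mono) auto
      ultimately show False using * by simp
    qed
  qed
  then show ?thesis by (simp add: poly_rootpoly_rev)
qed

lemma szegoS_eq_rootpoly_rev:
  assumes "cmod c = 1" "szegoF \<beta> n c = rootpoly n r"
  shows "szegoS \<beta> n c = smult c (rootpoly_rev n r)"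
  using szego_reversed_on_circle[OF assms(1)] assms(2)
  by (intro poly_eq_if_eq_on_circle) (simp add: rootpoly_rev_on_circle)

lemma monic_complex_poly_rootpoly:
  assumes "degree p = k" "lead_coeff p = 1"
  obtains r where "p = rootpoly k r"
proof -
  obtain r where "smult (lead_coeff p) (\<Prod>i<degree p. [:- r i, 1:]) = p"
    by (rule complex_poly_decompose')
  then have "p = rootpoly k r"
    using assms(2) unfolding rootpoly_def assms(1)[symmetric] by simp
  then show ?thesis by (rule that)
qed

text \<open>
  Zeros are listed with repetitions, so divisibility by their product is the way to express
  multiplicity; factors that do not vanish at the listed points can be cancelled one linear
  factor at a time.
\<close>

lemma rootpoly_dvd_mult_cancel:
  assumes "rootpoly m z dvd u * p" "\<And>i. i < m \<Longrightarrow> poly u (z i) \<noteq> 0"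
  shows "rootpoly m z dvd p"
  using assms
proof (induction m)
  case 0
  then show ?case by (simp add: rootpoly_def)
next
  case (Suc m)
  have split: "rootpoly (Suc m) z = rootpoly m z * [:- z m, 1:]"
    unfolding rootpoly_def by (rule prod.lessThan_Suc)
  have dvd: "rootpoly m z * [:- z m, 1:] dvd u * p"
    using Suc.prems(1) by (simp only: split)
  have "rootpoly m z dvd p"
    using dvd_mult_left[OF dvd] Suc.prems(2) by (rule Suc.IH) simp
  then obtain t where t: "p = rootpoly m z * t" by (elim dvdE)
  have "rootpoly m z * [:- z m, 1:] dvd rootpoly m z * (u * t)"
    using dvd unfolding t by (simp only: mult.left_commute)
  then have "[:- z m, 1:] dvd u * t"
    by (simp only: dvd_mult_cancel_left rootpoly_nonzero simp_thms)
  then have "poly u (z m) * poly t (z m) = 0"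
    by (simp only: poly_eq_0_iff_dvd[symmetric] poly_mult)
  then have "[:- z m, 1:] dvd t"
    using Suc.prems(2)[of m] by (simp add: poly_eq_0_iff_dvd)
  then show ?case unfolding split t by (rule mult_dvd_mono[OF dvd_refl])
qed

lemma rootpoly_dvd_unimodular_parameter:
  assumes "\<forall>j<n. cmod (\<beta> j) \<le> 1" "cmod c = 1" "j < n" "cmod (\<beta> j) = 1"
    and "\<forall>i<m. cmod (z i) < 1" "rootpoly m z dvd szegoF \<beta> n c"
  shows "\<exists>u. (\<forall>x. cmod x < 1 \<longrightarrow> poly u x \<noteq> 0) \<and>
    szegoF \<beta> n c = u * szegoF \<beta> j (cnj (\<beta> j)) \<and>
    szegoS \<beta> n c = u * szegoS \<beta> j (cnj (\<beta> j)) \<and>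
    rootpoly m z dvd szegoF \<beta> j (cnj (\<beta> j))"
proof -
  obtain u where u: "\<forall>x. cmod x < 1 \<longrightarrow> poly u x \<noteq> 0"
    "szegoF \<beta> n c = u * szegoF \<beta> j (cnj (\<beta> j))"
    "szegoS \<beta> n c = u * szegoS \<beta> j (cnj (\<beta> j))"
    using szego_unimodular_parameter[of n \<beta> c j, OF assms(1-4)] by blast
  have "rootpoly m z dvd szegoF \<beta> j (cnj (\<beta> j))"
  proof (rule rootpoly_dvd_mult_cancel[of m z u])
    show "rootpoly m z dvd u * szegoF \<beta> j (cnj (\<beta> j))" using assms(6) u(2) by simp
    show "poly u (z i) \<noteq> 0" if "i < m" for i using assms(5) u(1) that by blast
  qed
  with u show ?thesis by blast
qed

text \<open>
  A unimodular parameter with index \<open>j < m\<close> would leave a polynomial of degree \<open>j\<close> to carry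
  all \<open>m\<close> prescribed zeros.
\<close>

lemma head_parameters_in_disk:
  assumes "\<forall>j<n. cmod (\<beta> j) \<le> 1" "cmod c = 1" "m \<le> n"
    and "\<forall>i<m. cmod (z i) < 1" "rootpoly m z dvd szegoF \<beta> n c" "j < m"
  shows "cmod (\<beta> j) < 1"
proof (rule ccontr)
  assume "\<not> cmod (\<beta> j) < 1"
  then have 1: "cmod (\<beta> j) = 1" "j < n" using assms(1,3,6) by (auto simp: not_less order.antisym)
  have dvd: "rootpoly m z dvd szegoF \<beta> j (cnj (\<beta> j))"
    using rootpoly_dvd_unimodular_parameter[of n \<beta> c j m z, OF assms(1,2) 1(2,1) assms(4,5)] by blast
  have "m \<le> j" using dvd_imp_degree_le[OF dvd szegoF_neq_0] by (simp add: szego_monic(1))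
  with assms(6) show False by simp
qed

text \<open>
  The boundary value of the Blaschke product. If \<open>|\<beta>\<^sub>m| = 1\<close>, the prescribed zeros exhaust
  the recursion of length \<open>m\<close>, so the remaining factor is the polynomial \<open>u\<close> split off by
  the degeneration. Its reversal is \<open>cnj (c \<beta>\<^sub>m) u\<close>, by comparison of the second components.
\<close>

lemma blaschke_value_boundary:
  assumes "\<forall>j<m + k. cmod (\<beta> j) \<le> 1" "cmod c = 1" "0 < k" "cmod (\<beta> m) = 1"
    and "\<forall>i<m. cmod (z i) < 1"
    and F: "szegoF \<beta> (m + k) c = rootpoly m z * rootpoly k r"
    and x: "cmod x < 1"
  shows "poly (rootpoly k r) x = \<beta> m * c * poly (rootpoly_rev k r) x"
proof -
  have mk: "m < m + k" using assms(3) by simp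
  have d: "rootpoly m z dvd szegoF \<beta> (m + k) c" unfolding F by simp
  obtain u where u: "\<forall>x. cmod x < 1 \<longrightarrow> poly u x \<noteq> 0"
    "szegoF \<beta> (m + k) c = u * szegoF \<beta> m (cnj (\<beta> m))"
    "szegoS \<beta> (m + k) c = u * szegoS \<beta> m (cnj (\<beta> m))"
    "rootpoly m z dvd szegoF \<beta> m (cnj (\<beta> m))"
    using rootpoly_dvd_unimodular_parameter[of "m + k" \<beta> c m m z, OF assms(1,2) mk assms(4,5) d]
    by blast
  have Fm: "szegoF \<beta> m (cnj (\<beta> m)) = rootpoly m z"
  proof -
    obtain t where t: "szegoF \<beta> m (cnj (\<beta> m)) = rootpoly m z * t" using u(4) by (auto elim: dvdE)
    then have "t \<noteq> 0" using szegoF_neq_0[of \<beta> m "cnj (\<beta> m)"] by auto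
    then have "m = m + degree t"
      using arg_cong[OF t, of degree] by (simp add: degree_mult_eq szego_monic(1))
    then obtain s where s: "t = [:s:]" by (auto elim: degree_eq_zeroE)
    have "1 = s"
      using arg_cong[OF t, of lead_coeff] by (simp add: szego_monic(2) lead_coeff_mult s del: mult_pCons_right split: if_splits)
    then show ?thesis using t s by simp
  qed
  have Sm: "szegoS \<beta> m (cnj (\<beta> m)) = smult (cnj (\<beta> m)) (rootpoly_rev m z)"
    using assms(4) Fm by (intro szegoS_eq_rootpoly_rev) auto
  have q: "rootpoly k r = u"
    using F u(2) unfolding Fm by (simp add: mult.commute)
  have S: "poly (szegoS \<beta> (m + k) c) w = c * poly (rootpoly_rev m z) w * poly (rootpoly_rev k r) w"
    for w
  proof -
    have "szegoS \<beta> (m + k) c = smult c (rootpoly_rev m z * rootpoly_rev k r)"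
      using szego_reversed_on_circle[OF assms(2)] F
      by (intro poly_eq_if_eq_on_circle) (simp add: rootpoly_rev_on_circle power_add)
    then show ?thesis by simp
  qed
  have "c * poly (rootpoly_rev m z) x * poly (rootpoly_rev k r) x
      = poly u x * (cnj (\<beta> m) * poly (rootpoly_rev m z) x)"
    using S[of x] unfolding u(3) Sm by (auto simp: mult.left_commute mult.commute)
  moreover have "poly (rootpoly_rev m z) x \<noteq> 0"
    using assms(5) x by (intro rootpoly_rev_nonzero) (auto intro: less_imp_le)
  ultimately have "c * poly (rootpoly_rev k r) x = cnj (\<beta> m) * poly u x"
    by simp
  then have "\<beta> m * (c * poly (rootpoly_rev k r) x) = (\<beta> m * cnj (\<beta> m)) * poly u x"
    by simp
  moreover have "\<beta> m * cnj (\<beta> m) = 1"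
    using assms(4) by (simp add: complex_norm_square[symmetric])
  ultimately show ?thesis using q by (simp add: mult.assoc)
qed

text \<open>
  The real part at the centre is the mean over the circle, so it cannot vanish unless the
  non-positive boundary values do. The maximum principle for \<open>exp \<circ> g\<close> replaces the
  integral.
\<close>

lemma Re_zero_on_circle_if_nonpos:
  fixes g :: "complex \<Rightarrow> complex"
  assumes cont: "continuous_on (cball 0 1) g" and hol: "g holomorphic_on ball 0 1"
    and neg: "\<And>z. cmod z = 1 \<Longrightarrow> Re (g z) \<le> 0" and "g 0 = 0" and "cmod z = 1"
  shows "Re (g z) = 0"
proof -
  let ?e = "\<lambda>z. exp (g z)"
  have cont_e: "continuous_on (cball 0 1) ?e" and hol_e: "?e holomorphic_on ball 0 1"
    using cont hol by (auto intro!: continuous_intros holomorphic_intros)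
  have le: "norm (?e x) \<le> 1" if "x \<in> ball 0 1" for x
  proof (rule maximum_modulus_frontier[of ?e "ball 0 1"])
    show "\<And>z. z \<in> frontier (ball 0 1) \<Longrightarrow> norm (?e z) \<le> 1"
      using neg by (simp add: norm_exp_eq_Re)
  qed (use cont_e hol_e that in auto)
  have "?e constant_on ball 0 1"
  proof (rule maximum_modulus_principle[of ?e "ball 0 1" "ball 0 1" 0])
    show "norm (?e w) \<le> norm (?e 0)" if "w \<in> ball 0 1" for w
      using le[OF that] \<open>g 0 = 0\<close> by simp
  qed (use hol_e in auto)
  then obtain a where a: "\<And>w. w \<in> ball 0 1 \<Longrightarrow> ?e w = a"
    unfolding constant_on_def by blast
  have "?e z = a"
  proof (rule continuous_constant_on_closure[of "ball 0 1" ?e a z])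
    show "continuous_on (closure (ball 0 1)) ?e" using cont_e by simp
    show "z \<in> closure (ball 0 1)" using \<open>cmod z = 1\<close> by simp
  qed (rule a)
  moreover have "a = 1" using a[of 0] \<open>g 0 = 0\<close> by simp
  ultimately have "?e z = 1" by simp
  then have "norm (exp (g z)) = 1" by simp
  then show ?thesis by (simp only: norm_exp_eq_Re) simp
qed

section \<open>Uniqueness of the remaining zeros\<close>

text \<open>
  The recursion started from \<open>(1, -c)\<close> yields the polynomials of the second kind. The
  quotient is, up to sign, the Caratheodory function of the Bernstein--Szego weight
  \<open>K / |F|\<^sup>2\<close>, \<open>K\<close> being the determinant of the recursion.
\<close>

lemma caratheodory_Re_on_circle:
  assumes "cmod c = 1" "cmod z = 1" "poly (szegoF \<beta> n c) z \<noteq> 0"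
  shows "Re (poly (szegoS \<beta> n (- c)) z / poly (szegoS \<beta> n c) z)
       = - (\<Prod>j<n. 1 - (cmod (\<beta> j))\<^sup>2) / (cmod (poly (szegoF \<beta> n c) z))\<^sup>2"
proof -
  define F S G R where "F = poly (szegoF \<beta> n c) z" "S = poly (szegoS \<beta> n c) z"
    "G = poly (szegoF \<beta> n (- c)) z" "R = poly (szegoS \<beta> n (- c)) z"
  note defs = this
  define K where "K = (\<Prod>j<n. 1 - (cmod (\<beta> j))\<^sup>2)"
  have S: "S = c * z ^ n * cnj F" and R: "R = - (c * z ^ n * cnj G)"
    using szego_reversed_on_circle[of c z \<beta> n] szego_reversed_on_circle[of "-c" z \<beta> n] assms
    by (auto simp: defs)
  have cz: "c * z ^ n \<noteq> 0" using assms by auto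
  have "G * S - R * F = z ^ n * of_real K * (2 * c)"
    using szego_wronskian[of \<beta> n "(1, [:-c:])" z "(1, [:c:])"]
    by (simp add: defs szegoF_def szegoS_def K_def)
  then have "(c * z ^ n) * (G * cnj F + cnj G * F) = (c * z ^ n) * (2 * of_real K)"
    unfolding S R by (simp add: algebra_simps)
  then have *: "G * cnj F + cnj G * F = 2 * of_real K"
    using cz by (simp only: mult_cancel_left simp_thms)
  have F0: "F \<noteq> 0" using assms(3) by (simp add: defs)
  have "R / S = - (cnj G * F) / (cnj F * F)"
    unfolding S R using cz F0 by (simp add: field_simps)
  also have "cnj F * F = of_real ((cmod F)\<^sup>2)"
    by (simp add: complex_norm_square mult.commute del: of_real_power)
  finally have "Re (R / S) = - Re (cnj G * F) / (cmod F)\<^sup>2"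
    by (simp only: Re_divide_of_real uminus_complex.sel)
  moreover have "Re (cnj G * F) = K"
    using arg_cong[OF *, of Re] by (simp add: mult.commute)
  ultimately have "Re (R / S) = - K / (cmod F)\<^sup>2" by (simp only:)
  then show ?thesis by (simp only: defs K_def)
qed

text \<open>
  Two recursions with the same tail have Caratheodory functions that agree to order
  \<open>k + 1\<close> at \<open>0\<close>: one factor \<open>z ^ k\<close> comes from the determinant of the common tail, and
  one more from the constant terms of the second components, which the recursion preserves.
\<close>

lemma szego_tail_wronskian:
  assumes "\<And>j. m \<le> j \<Longrightarrow> j < m + k \<Longrightarrow> \<beta> j = \<gamma> j"
  obtains D where "poly D 0 = 0"
    "\<And>z. poly (szegoS \<beta> (m + k) (- c)) z * poly (szegoS \<gamma> (m + k) c) z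
        - poly (szegoS \<gamma> (m + k) (- c)) z * poly (szegoS \<beta> (m + k) c) z
      = z ^ k * of_real (\<Prod>j<k. 1 - (cmod (\<beta> (m + j)))\<^sup>2) * (2 * c) * poly D z"
proof -
  define f where "f = szego (\<lambda>i. \<beta> (m + i)) k (1, [:c:])"
  define g where "g = szego (\<lambda>i. \<beta> (m + i)) k (1, [:-c:])"
  define U where "U = (\<lambda>\<beta>. snd (szego \<beta> m (1, 0)))"
  define V where "V = (\<lambda>\<beta>. snd (szego \<beta> m (0, 1)))"
  have tail: "szego (\<lambda>i. \<gamma> (m + i)) k v = szego (\<lambda>i. \<beta> (m + i)) k v" for v
    using assms by (intro szego_cong) auto
  have lin: "snd (szego \<delta> m v) = fst v * U \<delta> + snd v * V \<delta>" for \<delta> v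
    using szego_linear[of \<delta> m "fst v" 1 "snd v" 0 0 1] by (simp add: U_def V_def)
  have S: "szegoS \<beta> (m + k) c = fst f * U \<beta> + snd f * V \<beta>"
      "szegoS \<gamma> (m + k) c = fst f * U \<gamma> + snd f * V \<gamma>"
      "szegoS \<beta> (m + k) (-c) = fst g * U \<beta> + snd g * V \<beta>"
      "szegoS \<gamma> (m + k) (-c) = fst g * U \<gamma> + snd g * V \<gamma>"
    by (simp_all add: szegoS_def szego_add tail lin f_def g_def)
  have W: "poly (fst g) z * poly (snd f) z - poly (snd g) z * poly (fst f) z
      = z ^ k * of_real (\<Prod>j<k. 1 - (cmod (\<beta> (m + j)))\<^sup>2) * (2 * c)" for z
    using szego_wronskian[of "\<lambda>i. \<beta> (m + i)" k "(1, [:-c:])" z "(1, [:c:])"]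
    by (simp add: f_def g_def)
  show thesis
  proof (rule that[of "U \<beta> * V \<gamma> - U \<gamma> * V \<beta>"])
    show "poly (U \<beta> * V \<gamma> - U \<gamma> * V \<beta>) 0 = 0"
      by (simp add: U_def szego_snd_at_0)
  next
    fix z
    have "poly (szegoS \<beta> (m + k) (- c)) z * poly (szegoS \<gamma> (m + k) c) z
        - poly (szegoS \<gamma> (m + k) (- c)) z * poly (szegoS \<beta> (m + k) c) z
      = (poly (fst g) z * poly (snd f) z - poly (snd g) z * poly (fst f) z)
        * poly (U \<beta> * V \<gamma> - U \<gamma> * V \<beta>) z"
      unfolding S by (simp add: algebra_simps)
    then show "poly (szegoS \<beta> (m + k) (- c)) z * poly (szegoS \<gamma> (m + k) c) z
        - poly (szegoS \<gamma> (m + k) (- c)) z * poly (szegoS \<beta> (m + k) c) z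
      = z ^ k * of_real (\<Prod>j<k. 1 - (cmod (\<beta> (m + j)))\<^sup>2) * (2 * c)
        * poly (U \<beta> * V \<gamma> - U \<gamma> * V \<beta>) z"
      unfolding W .
  qed
qed

text \<open>
  A Fejer--Riesz factorisation is unique: on the circle \<open>|p|\<^sup>2\<close> is \<open>p\<close> times its reversal,
  and only \<open>p\<close> itself has its zeros inside the disk.
\<close>

lemma rootpoly_eq_if_proportional_modulus:
  assumes "\<And>i. i < k \<Longrightarrow> cmod (r i) < 1" "\<And>i. i < k \<Longrightarrow> cmod (s i) < 1" "b \<noteq> 0"
    and "\<And>z. cmod z = 1 \<Longrightarrow>
      a * (cmod (poly (rootpoly k r) z))\<^sup>2 = b * (cmod (poly (rootpoly k s) z))\<^sup>2"
  shows "rootpoly k r = rootpoly k s"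
proof -
  have "smult (of_real a) (rootpoly k r * rootpoly_rev k r)
      = smult (of_real b) (rootpoly k s * rootpoly_rev k s)"
  proof (rule poly_eq_if_eq_on_circle)
    fix z :: complex
    assume z: "cmod z = 1"
    have *: "poly (rootpoly k t) z * poly (rootpoly_rev k t) z
        = z ^ k * of_real ((cmod (poly (rootpoly k t) z))\<^sup>2)" for t
      by (simp add: rootpoly_rev_on_circle[OF z] complex_norm_square mult_ac del: of_real_power)
    have "complex_of_real a * of_real ((cmod (poly (rootpoly k r) z))\<^sup>2)
        = of_real b * of_real ((cmod (poly (rootpoly k s) z))\<^sup>2)"
      using assms(4)[OF z] by (simp only: of_real_mult[symmetric])
    then show "poly (smult (of_real a) (rootpoly k r * rootpoly_rev k r)) z
        = poly (smult (of_real b) (rootpoly k s * rootpoly_rev k s)) z"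
      unfolding poly_smult poly_mult * by (metis mult.left_commute)
  qed
  then have "smult (of_real b) (rootpoly k s * rootpoly_rev k s)
      = rootpoly k r * smult (of_real a) (rootpoly_rev k r)"
    by simp
  then have "rootpoly k r dvd smult (of_real b) (rootpoly k s * rootpoly_rev k s)"
    by (rule dvdI)
  then have "rootpoly k r dvd rootpoly_rev k s * rootpoly k s"
    using assms(3) by (simp add: dvd_smult_iff mult.commute)
  then have "rootpoly k r dvd rootpoly k s"
  proof (rule rootpoly_dvd_mult_cancel)
    show "poly (rootpoly_rev k s) (r i) \<noteq> 0" if "i < k" for i
      using assms(1)[OF that] assms(2) by (intro rootpoly_rev_nonzero) (auto intro: less_imp_le)
  qed
  then obtain t where t: "rootpoly k s = rootpoly k r * t" by (elim dvdE)
  then have "t \<noteq> 0" using rootpoly_nonzero[of k s] by auto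
  then have "k = k + degree t"
    using arg_cong[OF t, of degree] by (simp add: degree_mult_eq)
  then obtain x where x: "t = [:x:]" by (auto elim: degree_eq_zeroE)
  have "coeff (rootpoly k s) k = x * coeff (rootpoly k r) k" unfolding t x by simp
  then have "x = 1" by simp
  then show ?thesis using t x by simp
qed

text \<open>
  Let \<open>h = \<kappa>\<^sub>\<beta> |s|\<^sup>2 - \<kappa>\<^sub>\<gamma> |r|\<^sup>2\<close> on the circle, where \<open>r\<close> and \<open>s\<close> stand for the two
  residual factors. It is a trigonometric polynomial of degree at most \<open>k\<close>, so its product
  \<open>g\<close> with the difference of the two Caratheodory functions extends analytically to the disk and
  vanishes at \<open>0\<close>. That difference has the real part
  \<open>- h / |Q r s|\<^sup>2\<close>, up to a positive factor, so \<open>g\<close> has real part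
  \<open>- h\<^sup>2 / |Q r s|\<^sup>2\<close> on the circle. Hence \<open>h = 0\<close>.
\<close>

lemma residual_zeros_unique:
  assumes \<beta>: "\<And>j. j < m + k \<Longrightarrow> cmod (\<beta> j) < 1" and \<gamma>: "\<And>j. j < m + k \<Longrightarrow> cmod (\<gamma> j) < 1"
    and tail: "\<And>j. m \<le> j \<Longrightarrow> j < m + k \<Longrightarrow> \<beta> j = \<gamma> j" and c: "cmod c = 1"
    and F\<beta>: "szegoF \<beta> (m + k) c = rootpoly m z * rootpoly k r"
    and F\<gamma>: "szegoF \<gamma> (m + k) c = rootpoly m z * rootpoly k s"
  shows "rootpoly k r = rootpoly k s"
proof -
  define N where "N = m + k"
  define \<kappa> where "\<kappa> = (\<lambda>\<delta>. \<Prod>j<m. 1 - (cmod (\<delta> j :: complex))\<^sup>2)"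
  define \<tau> where "\<tau> = (\<Prod>j<k. 1 - (cmod (\<beta> (m + j)))\<^sup>2)"
  have pos1: "0 < 1 - (cmod w)\<^sup>2" if "cmod w < 1" for w :: complex
    using that by (simp add: abs_square_less_1)
  have \<kappa>\<beta>: "\<kappa> \<beta> > 0" unfolding \<kappa>_def by (intro prod_pos pos1 \<beta>) auto
  have \<tau>: "\<tau> > 0" unfolding \<tau>_def by (intro prod_pos pos1 \<beta>) auto
  have K: "(\<Prod>j<m + n. 1 - (cmod (\<delta> j))\<^sup>2) = \<kappa> \<delta> * (\<Prod>j<n. 1 - (cmod (\<delta> (m + j)))\<^sup>2)" for \<delta> n
    by (induction n) (simp_all add: \<kappa>_def mult.assoc)
  have K\<beta>: "(\<Prod>j<m + k. 1 - (cmod (\<beta> j))\<^sup>2) = \<kappa> \<beta> * \<tau>"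
    by (simp add: K \<tau>_def)
  have K\<gamma>: "(\<Prod>j<m + k. 1 - (cmod (\<gamma> j))\<^sup>2) = \<kappa> \<gamma> * \<tau>"
    unfolding K \<tau>_def using tail by (intro arg_cong2[where f = "(*)"] prod.cong) auto
  obtain D where D0: "poly D 0 = 0" and D: "\<And>z. poly (szegoS \<beta> N (- c)) z * poly (szegoS \<gamma> N c) z
        - poly (szegoS \<gamma> N (- c)) z * poly (szegoS \<beta> N c) z
      = z ^ k * of_real \<tau> * (2 * c) * poly D z"
    using szego_tail_wronskian[of m k \<beta> \<gamma> c, OF tail] unfolding N_def \<tau>_def by blast
  \<comment> \<open>\<open>H\<close> is \<open>z ^ k * h\<close> continued from the circle to a polynomial. The factor \<open>z ^ k\<close> in the numerator of the difference of the Caratheodory functions absorbs the power and does not appear in \<open>g\<close>.\<close>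
  define H where "H = smult (of_real (\<kappa> \<beta>)) (rootpoly k s * rootpoly_rev k s)
     - smult (of_real (\<kappa> \<gamma>)) (rootpoly k r * rootpoly_rev k r)"
  define h where "h = (\<lambda>x. \<kappa> \<beta> * (cmod (poly (rootpoly k s) x))\<^sup>2 - \<kappa> \<gamma> * (cmod (poly (rootpoly k r) x))\<^sup>2)"
  define g where "g = (\<lambda>x. poly H x * (2 * c) * poly D x / (poly (szegoS \<beta> N c) x * poly (szegoS \<gamma> N c) x))"
  have S: "poly (szegoS \<beta> N c) x \<noteq> 0" "poly (szegoS \<gamma> N c) x \<noteq> 0" if "cmod x \<le> 1" for x
    using szegoS_nonzero_cball[of N \<beta> c x] szegoS_nonzero_cball[of N \<gamma> c x] \<beta> \<gamma> c that
    by (auto simp: N_def)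
  have Re_g: "Re (g x) = - ((h x)\<^sup>2 /
      ((cmod (poly (rootpoly m z) x))\<^sup>2 * (cmod (poly (rootpoly k r) x))\<^sup>2 * (cmod (poly (rootpoly k s) x))\<^sup>2))"
    and nz: "poly (rootpoly m z) x \<noteq> 0" "poly (rootpoly k r) x \<noteq> 0" "poly (rootpoly k s) x \<noteq> 0"
    if x: "cmod x = 1" for x
  proof -
    have F: "poly (szegoF \<beta> N c) x \<noteq> 0" "poly (szegoF \<gamma> N c) x \<noteq> 0"
      using szegoF_nonzero_outside[of N \<beta> c x] szegoF_nonzero_outside[of N \<gamma> c x] \<beta> \<gamma> c x
      by (auto simp: N_def)
    then show nz: "poly (rootpoly m z) x \<noteq> 0" "poly (rootpoly k r) x \<noteq> 0" "poly (rootpoly k s) x \<noteq> 0"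
      by (simp_all add: N_def F\<beta> F\<gamma>)
    have *: "poly (rootpoly k t) x * poly (rootpoly_rev k t) x
        = x ^ k * of_real ((cmod (poly (rootpoly k t) x))\<^sup>2)" for t
      by (simp add: rootpoly_rev_on_circle[OF x] complex_norm_square mult_ac del: of_real_power)
    have Hx: "poly H x = x ^ k * of_real (h x)"
      unfolding H_def poly_diff poly_smult poly_mult * h_def by (simp add: algebra_simps)
    let ?S = "poly (szegoS \<beta> N c) x" and ?S' = "poly (szegoS \<gamma> N c) x"
    let ?R = "poly (szegoS \<beta> N (- c)) x" and ?R' = "poly (szegoS \<gamma> N (- c)) x"
    have "of_real \<tau> * g x = of_real (h x) * (x ^ k * of_real \<tau> * (2 * c) * poly D x) / (?S * ?S')"
      unfolding g_def Hx by simp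
    also have "\<dots> = of_real (h x) * (?R / ?S - ?R' / ?S')"
    proof -
      have "?R / ?S - ?R' / ?S' = (?R * ?S' - ?R' * ?S) / (?S * ?S')"
        using S[of x] x by (simp add: diff_frac_eq)
      then show ?thesis unfolding D by simp
    qed
    finally have "Re (of_real \<tau> * g x) = Re (of_real (h x) * (?R / ?S - ?R' / ?S'))"
      by (rule arg_cong)
    then have "\<tau> * Re (g x) = h x * (Re (?R / ?S) - Re (?R' / ?S'))"
      by simp
    also have "\<dots> = \<tau> * (h x * (\<kappa> \<gamma> / (cmod (poly (szegoF \<gamma> N c) x))\<^sup>2
        - \<kappa> \<beta> / (cmod (poly (szegoF \<beta> N c) x))\<^sup>2))"
      using caratheodory_Re_on_circle[OF c x F(1)] caratheodory_Re_on_circle[OF c x F(2)] K\<beta> K\<gamma>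
      by (simp add: N_def algebra_simps)
    finally have "Re (g x) = h x * (\<kappa> \<gamma> / (cmod (poly (szegoF \<gamma> N c) x))\<^sup>2
        - \<kappa> \<beta> / (cmod (poly (szegoF \<beta> N c) x))\<^sup>2)"
      using \<tau> by simp
    also have "\<dots> = - ((h x)\<^sup>2 /
      ((cmod (poly (rootpoly m z) x))\<^sup>2 * (cmod (poly (rootpoly k r) x))\<^sup>2 * (cmod (poly (rootpoly k s) x))\<^sup>2))"
      using nz by (simp add: N_def F\<beta> F\<gamma> h_def norm_mult divide_simps) (simp add: power2_eq_square algebra_simps)
    finally show "Re (g x) = - ((h x)\<^sup>2 /
      ((cmod (poly (rootpoly m z) x))\<^sup>2 * (cmod (poly (rootpoly k r) x))\<^sup>2 * (cmod (poly (rootpoly k s) x))\<^sup>2))" .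
  qed
  have h0: "h x = 0" if x: "cmod x = 1" for x
  proof -
    have "Re (g x) = 0"
    proof (rule Re_zero_on_circle_if_nonpos[of g x])
      show "continuous_on (cball 0 1) g"
        unfolding g_def using S by (intro continuous_intros) auto
      show "g holomorphic_on ball 0 1"
        unfolding g_def using S by (intro holomorphic_intros) auto
      show "\<And>z. cmod z = 1 \<Longrightarrow> Re (g z) \<le> 0" by (simp add: Re_g)
      show "g 0 = 0" by (simp add: g_def D0)
    qed (rule x)
    then show ?thesis using Re_g[OF x] nz[OF x] by simp
  qed
  have roots: "cmod (r i) < 1" "cmod (s i) < 1" if "i < k" for i
  proof -
    have "poly (szegoF \<beta> N c) (r i) = 0" "poly (szegoF \<gamma> N c) (s i) = 0"
      using that by (auto simp: N_def F\<beta> F\<gamma> poly_rootpoly_eq_0)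
    then show "cmod (r i) < 1" "cmod (s i) < 1"
      using szegoF_nonzero_outside[of N \<beta> c "r i"] szegoF_nonzero_outside[of N \<gamma> c "s i"] \<beta> \<gamma> c
      by (auto simp: N_def not_less[symmetric])
  qed
  show ?thesis
    by (rule rootpoly_eq_if_proportional_modulus[where a = "\<kappa> \<gamma>" and b = "\<kappa> \<beta>"])
       (use roots h0 \<kappa>\<beta> in \<open>auto simp: h_def\<close>)
qed

section \<open>Existence of the missing parameters\<close>

text \<open>
  Parameter sequences are taken as functions on all of \<open>nat\<close> with the product topology, so that
  their number need not be encoded in a type; Tychonoff provides compactness.
\<close>

lemma compact_polydisc: "compact {b :: nat \<Rightarrow> complex. \<forall>i. cmod (b i) \<le> 1}"
proof -
  have "compactin (product_topology (\<lambda>i::nat. euclidean :: complex topology) UNIV)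
      (PiE UNIV (\<lambda>i. cball 0 1))"
    by (subst compactin_PiE) (auto simp: compactin_euclidean_iff)
  moreover have "PiE UNIV (\<lambda>i::nat. cball (0::complex) 1) = {b. \<forall>i. cmod (b i) \<le> 1}"
    by (auto simp: PiE_iff)
  ultimately show ?thesis
    by (simp add: euclidean_product_topology compactin_euclidean_iff)
qed

lemma continuous_on_coordinate [continuous_intros]:
  "continuous_on A (\<lambda>b :: nat \<Rightarrow> complex. b i)"
  by (rule continuous_on_subset[OF continuous_on_product_coordinates]) simp

lemma continuous_on_szego:
  assumes "continuous_on A (\<lambda>b. poly (fst (v b)) x)" "continuous_on A (\<lambda>b. poly (snd (v b)) x)"
  shows "continuous_on A (\<lambda>b. poly (fst (szego b n (v b))) x)"
  using assms
proof (induction n arbitrary: v)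
  case 0
  then show ?case by simp
next
  case (Suc n)
  have "continuous_on A (\<lambda>b. poly (fst (szego b n (szego_step (b n) (v b)))) x)"
    by (rule Suc.IH) (use Suc.prems in \<open>auto simp: szego_step_def intro!: continuous_intros\<close>)
  then show ?case by simp
qed

text \<open>
  Otherwise \<open>h / |h|\<close> would retract the disk onto its boundary.
\<close>

lemma fixes_circle_imp_zero:
  fixes h :: "complex \<Rightarrow> complex"
  assumes "continuous_on (cball 0 1) h" "\<And>a. cmod a = 1 \<Longrightarrow> h a = a"
  obtains a where "cmod a < 1" "h a = 0"
proof -
  have "\<exists>a\<in>cball 0 1. h a = 0"
  proof (rule ccontr)
    assume "\<not> ?thesis"
    then have nz: "h a \<noteq> 0" if "cmod a \<le> 1" for a using that by auto
    have "retraction (cball 0 1) (sphere 0 1) (\<lambda>a. h a / of_real (cmod (h a)))"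
      unfolding retraction_def using assms nz
      by (auto intro!: continuous_intros simp: norm_divide)
    then have "frontier (cball (0::complex) 1) retract_of cball 0 1"
      unfolding retract_of_def by auto
    then show False using no_retraction_cball[of 1 "0::complex"] by simp
  qed
  then obtain a where "cmod a \<le> 1" "h a = 0" by auto
  moreover from this have "cmod a \<noteq> 1" using assms(2)[of a] by auto
  ultimately show thesis using that[of a] by simp
qed

text \<open>
  One more zero \<open>x\<close> is bought with the parameter of index \<open>m\<close>, called \<open>a\<close> in the
  hypothesis, which the induction hypothesis leaves free.
\<close>

lemma prescribed_zeros_step:
  assumes IH: "\<And>a. cmod a < 1 \<Longrightarrow> \<exists>\<beta>. (\<forall>j<m. cmod (\<beta> j) < 1) \<and> \<beta> m = a \<and>
      (\<forall>j<k. \<beta> (Suc m + j) = t j) \<and> rootpoly m z dvd szegoF \<beta> (m + Suc k) c"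
    and c: "cmod c = 1" and t: "\<forall>j<k. cmod (t j) < 1"
    and z: "\<forall>i<m. cmod (z i) < 1" and x: "cmod x < 1"
  shows "\<exists>\<beta>. (\<forall>j<Suc m. cmod (\<beta> j) < 1) \<and> (\<forall>j<k. \<beta> (Suc m + j) = t j) \<and>
      rootpoly m z * [:- x, 1:] dvd szegoF \<beta> (m + Suc k) c"
proof -
  define N where "N = m + Suc k"
  define B where "B = {b :: nat \<Rightarrow> complex. \<forall>i. cmod (b i) \<le> 1}"
  \<comment> \<open>The solutions: parameters together with a list of the remaining zeros. Carrying the zeros along makes divisibility a closed condition, also when zeros coincide.\<close>
  define K where "K = {p \<in> B \<times> B. (\<forall>j<k. fst p (Suc m + j) = t j) \<and>
     (\<forall>w. poly (szegoF (fst p) N c) w = poly (rootpoly m z) w * (\<Prod>i<Suc k. w - snd p i))}"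
  \<comment> \<open>The normalised Blaschke product of the remaining zeros, at \<open>x\<close>.\<close>
  define y where "y = (\<lambda>r. cnj c * (\<Prod>i<Suc k. x - r i) / (\<Prod>i<Suc k. 1 - cnj (r i) * x))"
  have K_iff: "(\<beta>, r) \<in> K \<longleftrightarrow> \<beta> \<in> B \<and> r \<in> B \<and> (\<forall>j<k. \<beta> (Suc m + j) = t j) \<and>
      szegoF \<beta> N c = rootpoly m z * rootpoly (Suc k) r" for \<beta> r
    by (simp add: K_def poly_eq_poly_eq_iff[symmetric] fun_eq_iff poly_rootpoly)
  have y_eq: "y r = cnj c * poly (rootpoly (Suc k) r) x / poly (rootpoly_rev (Suc k) r) x" for r
    by (simp only: y_def poly_rootpoly poly_rootpoly_rev)
  have rev_nz: "poly (rootpoly_rev (Suc k) r) x \<noteq> 0" if "r \<in> B" for r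
    using that x by (intro rootpoly_rev_nonzero) (auto simp: B_def)
  have head: "cmod (\<beta> j) < 1" if "(\<beta>, r) \<in> K" "j < m" for \<beta> r j
    by (rule head_parameters_in_disk[of N \<beta> c m z j])
       (use that c z in \<open>auto simp: K_iff B_def N_def\<close>)
  have all: "cmod (\<beta> j) < 1" if "(\<beta>, r) \<in> K" "cmod (\<beta> m) < 1" "j < N" for \<beta> r j
  proof -
    show ?thesis
    proof (cases j m rule: linorder_cases)
      case greater
      then have j: "j = Suc m + (j - Suc m)" "j - Suc m < k" using that(3) by (auto simp: N_def)
      then have "\<beta> j = t (j - Suc m)" using that(1) unfolding K_iff by metis
      then show ?thesis using t j(2) by simp
    qed (use that head[OF that(1)] in auto)
  qed
  have "compact K"
  proof -
    have "compact (B \<times> B)" unfolding B_def by (intro compact_Times compact_polydisc)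
    moreover have "closed {p :: (nat \<Rightarrow> complex) \<times> (nat \<Rightarrow> complex). (\<forall>j<k. fst p (Suc m + j) = t j) \<and>
       (\<forall>w. poly (szegoF (fst p) N c) w = poly (rootpoly m z) w * (\<Prod>i<Suc k. w - snd p i))}"
    proof (intro closed_Collect_conj closed_Collect_all closed_Collect_imp closed_Collect_eq)
      fix j show "continuous_on UNIV (\<lambda>p :: (nat \<Rightarrow> complex) \<times> (nat \<Rightarrow> complex). fst p (Suc m + j))"
        by (rule continuous_on_compose2[OF continuous_on_coordinate[of UNIV]]) (auto intro: continuous_intros)
    next
      fix w
      have "continuous_on UNIV (\<lambda>b. poly (szegoF b N c) w)"
        unfolding szegoF_def by (rule continuous_on_szego) (auto intro: continuous_intros)
      from continuous_on_compose2[OF this continuous_on_fst[OF continuous_on_id]]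
      show "continuous_on UNIV (\<lambda>p :: (nat \<Rightarrow> complex) \<times> (nat \<Rightarrow> complex). poly (szegoF (fst p) N c) w)"
        by simp
      have "continuous_on UNIV (\<lambda>b. poly (rootpoly m z) w * (\<Prod>i<Suc k. w - b i))"
        by (intro continuous_intros)
      from continuous_on_compose2[OF this continuous_on_snd[OF continuous_on_id]]
      show "continuous_on UNIV (\<lambda>p :: (nat \<Rightarrow> complex) \<times> (nat \<Rightarrow> complex).
          poly (rootpoly m z) w * (\<Prod>i<Suc k. w - snd p i))"
        by simp
    qed (auto intro: continuous_intros)
    moreover have "K = (B \<times> B) \<inter> {p. (\<forall>j<k. fst p (Suc m + j) = t j) \<and>
       (\<forall>w. poly (szegoF (fst p) N c) w = poly (rootpoly m z) w * (\<Prod>i<Suc k. w - snd p i))}"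
      unfolding K_def by auto
    ultimately show ?thesis by (simp only: compact_Int_closed)
  qed
  \<comment> \<open>The graph of the function \<open>h\<close>, before it is known to be one.\<close>
  define \<Gamma> where "\<Gamma> = (\<lambda>p. (fst p m, y (snd p))) ` K"
  have "compact \<Gamma>"
    unfolding \<Gamma>_def
  proof (rule compact_continuous_image[OF _ \<open>compact K\<close>])
    have "continuous_on K (\<lambda>p. fst p m)"
      by (rule continuous_on_compose2[OF continuous_on_coordinate[of UNIV]]) (auto intro: continuous_intros)
    moreover have "continuous_on B y"
      unfolding y_def
    proof (intro continuous_intros ballI)
      fix r assume "r \<in> B"
      then show "(\<Prod>i<Suc k. 1 - cnj (r i) * x) \<noteq> 0"
        using rev_nz[of r] by (simp only: poly_rootpoly_rev not_False_eq_True)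
    qed
    then have "continuous_on K (\<lambda>p. y (snd p))"
      by (rule continuous_on_compose2) (auto simp: K_def intro: continuous_intros)
    ultimately show "continuous_on K (\<lambda>p. (fst p m, y (snd p)))"
      by (rule continuous_on_Pair)
  qed
  have \<Gamma>_cball: "cmod a \<le> 1" if "(a, w) \<in> \<Gamma>" for a w
    using that by (auto simp: \<Gamma>_def K_def B_def)
  have ex_ball: "a \<in> fst ` \<Gamma>" if a: "a \<in> ball 0 1" for a
  proof -
    obtain \<beta> where \<beta>: "\<forall>j<m. cmod (\<beta> j) < 1" "\<beta> m = a" "\<forall>j<k. \<beta> (Suc m + j) = t j"
      "rootpoly m z dvd szegoF \<beta> N c"
      using IH[of a] a unfolding N_def by auto
    \<comment> \<open>The values beyond \<open>N\<close> are reset so that the whole sequence lies in the polydisc.\<close>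
    define b where "b = (\<lambda>j. if j < N then \<beta> j else 0)"
    have b: "cmod (b j) < 1" for j
    proof (cases "j < N")
      case True
      have "cmod (\<beta> j) < 1"
      proof (cases j m rule: linorder_cases)
        case greater
        then have j: "j = Suc m + (j - Suc m)" "j - Suc m < k" using True by (auto simp: N_def)
        then have "\<beta> j = t (j - Suc m)" using \<beta>(3) by metis
        then show ?thesis using t j(2) by simp
      qed (use \<beta>(1,2) a in auto)
      then show ?thesis using True by (simp add: b_def)
    qed (simp add: b_def)
    have bF: "szegoF b N c = szegoF \<beta> N c"
      unfolding szegoF_def by (subst szego_cong[of N b \<beta>]) (auto simp: b_def)
    obtain q where q: "szegoF b N c = rootpoly m z * q" using \<beta>(4) bF by (auto elim: dvdE)
    then have q0: "q \<noteq> 0" using szegoF_neq_0[of b N c] by auto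
    have "degree q = Suc k"
      using arg_cong[OF q, of degree] q0 by (simp add: degree_mult_eq szego_monic(1) N_def)
    moreover have "lead_coeff q = 1"
      using arg_cong[OF q, of lead_coeff] unfolding lead_coeff_mult szego_monic(2) rootpoly_monic(2) by simp
    ultimately obtain r where r: "q = rootpoly (Suc k) r" by (rule monic_complex_poly_rootpoly)
    define s where "s = (\<lambda>i. if i < Suc k then r i else 0)"
    have s: "q = rootpoly (Suc k) s"
      unfolding r rootpoly_def by (intro prod.cong) (auto simp: s_def)
    have "cmod (s i) \<le> 1" for i
    proof (cases "i < Suc k")
      case True
      then have "poly (szegoF b N c) (s i) = 0" by (auto simp: q s poly_rootpoly_eq_0)
      then show ?thesis
        using szegoF_nonzero_outside[of N b c "s i"] b c by (metis linear)
    qed (simp add: s_def)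
    then have "(b, s) \<in> K"
      using b \<beta>(3) q s by (auto simp: K_iff B_def b_def N_def less_imp_le)
    moreover have "b m = a" using \<beta>(2) by (simp add: b_def N_def)
    ultimately show ?thesis unfolding \<Gamma>_def by force
  qed
  have ex: "\<exists>w. (a, w) \<in> \<Gamma>" if "a \<in> cball 0 1" for a
  proof -
    \<comment> \<open>Solutions over the boundary circle are limits of solutions over the open disk.\<close>
    have "closed (fst ` \<Gamma>)"
      using \<open>compact \<Gamma>\<close> by (intro compact_imp_closed compact_continuous_image continuous_intros)
    moreover have "ball 0 1 \<subseteq> fst ` \<Gamma>" using ex_ball by blast
    ultimately have "closure (ball 0 1) \<subseteq> fst ` \<Gamma>" by (rule closure_minimal[rotated])
    then show ?thesis using that by force
  qed
  have boundary: "w = a" if aw: "(a, w) \<in> \<Gamma>" "cmod a = 1" for a w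
  proof -
    obtain \<beta> r where p: "(\<beta>, r) \<in> K" "a = \<beta> m" "w = y r" using aw unfolding \<Gamma>_def by auto
    have val: "poly (rootpoly (Suc k) r) x = \<beta> m * c * poly (rootpoly_rev (Suc k) r) x"
      by (rule blaschke_value_boundary[of m "Suc k" \<beta> c z r x])
         (use p aw(2) c z x in \<open>auto simp: K_iff B_def N_def\<close>)
    have "cnj c * c = 1" using c by (simp add: complex_norm_square[symmetric] mult.commute)
    have "y r = \<beta> m * ((cnj c * c) * poly (rootpoly_rev (Suc k) r) x)
        / poly (rootpoly_rev (Suc k) r) x"
      unfolding y_eq val by (simp only: mult_ac)
    also have "\<dots> = \<beta> m"
      using \<open>cnj c * c = 1\<close> rev_nz[of r] p(1) by (simp add: K_iff)
    finally show ?thesis using p by simp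
  qed
  have unique: "w = w'" if aw: "(a, w) \<in> \<Gamma>" and aw': "(a, w') \<in> \<Gamma>" for a w w'
  proof (cases "cmod a = 1")
    case True
    then show ?thesis using boundary[OF aw] boundary[OF aw'] by simp
  next
    case False
    then have a: "cmod a < 1" using \<Gamma>_cball[OF aw] by simp
    obtain \<beta> r where p: "(\<beta>, r) \<in> K" "a = \<beta> m" "w = y r" using aw unfolding \<Gamma>_def by auto
    obtain \<gamma> s where q: "(\<gamma>, s) \<in> K" "a = \<gamma> m" "w' = y s" using aw' unfolding \<Gamma>_def by auto
    have tail: "\<beta> j = \<gamma> j" if "m \<le> j" "j < m + Suc k" for j
    proof (cases "j = m")
      case True then show ?thesis using p(2) q(2) by simp
    next
      case False
      then have "j = Suc m + (j - Suc m)" "j - Suc m < k" using that by linarith+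
      then show ?thesis using p(1) q(1) unfolding K_iff by metis
    qed
    have rs: "rootpoly (Suc k) r = rootpoly (Suc k) s"
      by (rule residual_zeros_unique[of m "Suc k" \<beta> \<gamma> c z r s])
         (use p q a c tail all[OF p(1)] all[OF q(1)] in \<open>auto simp: K_iff N_def\<close>)
    then have "rootpoly_rev (Suc k) r = rootpoly_rev (Suc k) s"
      by (intro poly_eq_if_eq_on_circle) (simp add: rootpoly_rev_on_circle)
    with rs show ?thesis by (simp add: p q y_eq)
  qed
  obtain h where h: "\<And>a. a \<in> cball 0 1 \<Longrightarrow> (a, h a) \<in> \<Gamma>" using ex by metis
  have graph: "(\<lambda>a. (a, h a)) ` cball 0 1 = \<Gamma>"
  proof (intro equalityI subsetI)
    fix p assume p: "p \<in> \<Gamma>"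
    then have "fst p \<in> cball 0 1" using \<Gamma>_cball[of "fst p" "snd p"] by simp
    moreover from this have "snd p = h (fst p)" using unique[of "fst p" "snd p"] h p by simp
    ultimately show "p \<in> (\<lambda>a. (a, h a)) ` cball 0 1" by (intro image_eqI[of _ _ "fst p"]) (simp_all add: prod_eq_iff)
  qed (use h in auto)
  have "continuous_on (cball 0 1) h"
  proof (rule continuous_from_closed_graph)
    show "compact (snd ` \<Gamma>)"
      using \<open>compact \<Gamma>\<close> by (intro compact_continuous_image continuous_intros)
    show "h \<in> cball 0 1 \<rightarrow> snd ` \<Gamma>" using h by force
    show "closed ((\<lambda>a. (a, h a)) ` cball 0 1)"
      unfolding graph using \<open>compact \<Gamma>\<close> by (rule compact_imp_closed)
  qed
  moreover have "h a = a" if "cmod a = 1" for a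
    using boundary[of a "h a"] h[of a] that by simp
  ultimately obtain a where a: "cmod a < 1" "h a = 0" by (rule fixes_circle_imp_zero)
  then have "(a, 0) \<in> \<Gamma>" using h[of a] by simp
  then obtain \<beta> r where p: "(\<beta>, r) \<in> K" "\<beta> m = a" "y r = 0" unfolding \<Gamma>_def by auto
  have "c \<noteq> 0" using c by auto
  then have "poly (rootpoly (Suc k) r) x = 0"
    using p(3) rev_nz[of r] p(1) by (simp add: y_eq K_iff)
  then have "[:- x, 1:] dvd rootpoly (Suc k) r" by (simp only: poly_eq_0_iff_dvd)
  then have "rootpoly m z * [:- x, 1:] dvd szegoF \<beta> N c"
    using p(1) by (simp only: K_iff mult_dvd_mono[OF dvd_refl])
  moreover have "\<forall>j<Suc m. cmod (\<beta> j) < 1" using head[OF p(1)] a(1) p(2) by (auto simp: less_Suc_eq)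
  ultimately show ?thesis using p(1) unfolding N_def[symmetric] K_iff by blast
qed

lemma prescribed_zeros:
  assumes "cmod c = 1" "\<forall>i<m. cmod (z i) < 1" "\<forall>j<k. cmod (t j) < 1"
  shows "\<exists>\<beta>. (\<forall>j<m. cmod (\<beta> j) < 1) \<and> (\<forall>j<k. \<beta> (m + j) = t j) \<and>
      rootpoly m z dvd szegoF \<beta> (m + k) c"
  using assms(2,3)
proof (induction m arbitrary: k t)
  case 0
  show ?case by (intro exI[of _ t]) (simp add: rootpoly_def)
next
  case (Suc m)
  have "\<exists>\<beta>. (\<forall>j<Suc m. cmod (\<beta> j) < 1) \<and> (\<forall>j<k. \<beta> (Suc m + j) = t j) \<and>
      rootpoly m z * [:- z m, 1:] dvd szegoF \<beta> (m + Suc k) c"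
  proof (rule prescribed_zeros_step[OF _ assms(1) Suc.prems(2)])
    fix a :: complex
    assume a: "cmod a < 1"
    define t' where "t' = (\<lambda>j. case j of 0 \<Rightarrow> a | Suc i \<Rightarrow> t i)"
    have "\<forall>j<Suc k. cmod (t' j) < 1"
      using a Suc.prems(2) by (auto simp: t'_def split: nat.split)
    then obtain \<beta> where \<beta>: "\<forall>j<m. cmod (\<beta> j) < 1" "\<forall>j<Suc k. \<beta> (m + j) = t' j"
        "rootpoly m z dvd szegoF \<beta> (m + Suc k) c"
      using Suc.IH[of "Suc k" t'] Suc.prems(1) by auto
    have "\<beta> m = a" using \<beta>(2)[rule_format, of 0] by (simp add: t'_def)
    moreover have "\<beta> (Suc m + j) = t j" if "j < k" for j
      using \<beta>(2)[rule_format, of "Suc j"] that by (simp add: t'_def)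
    ultimately show "\<exists>\<beta>. (\<forall>j<m. cmod (\<beta> j) < 1) \<and> \<beta> m = a \<and>
      (\<forall>j<k. \<beta> (Suc m + j) = t j) \<and> rootpoly m z dvd szegoF \<beta> (m + Suc k) c"
      using \<beta>(1,3) by blast
  qed (use Suc.prems(1) in auto)
  then show ?case by (simp add: rootpoly_def lessThan_Suc mult.commute)
qed

section \<open>The characteristic polynomial of a truncated CMV matrix\<close>

definition cmv_char :: "nat \<Rightarrow> (nat \<Rightarrow> complex) \<Rightarrow> complex poly mat" where
  "cmv_char n \<alpha> = Matrix.mat n n (\<lambda>(i, j).
     (if i = j then [:0, 1:] else 0) - [:cmv_entry \<alpha> (i + 1) (j + 1):])"

text \<open>
  The first row of \<open>X - T\<close> is \<open>X e\<^sub>1\<close> plus \<open>\<alpha>\<^sub>0\<close> times the row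
  \<open>(cnj \<alpha>\<^sub>1, \<rho>\<^sub>1, 0, \<dots>)\<close>. The matrix with that row in place of the first one has
  the second component of the Szego recursion as its determinant.
\<close>

definition cmv_row_char :: "nat \<Rightarrow> (nat \<Rightarrow> complex) \<Rightarrow> complex poly mat" where
  "cmv_row_char n \<alpha> = Matrix.mat n n (\<lambda>(i, j).
     if i = 0 then (if j = 0 then [:cnj (\<alpha> 1):] else if j = 1 then [:cmv_rho \<alpha> 1:] else 0)
     else cmv_char n \<alpha> $$ (i, j))"

lemma cmv_char_carrier [simp]:
  "cmv_char n \<alpha> \<in> carrier_mat n n" "cmv_row_char n \<alpha> \<in> carrier_mat n n"
  by (simp_all add: cmv_char_def cmv_row_char_def)

lemma char_poly_cmv_mat: "char_poly (cmv_mat n \<alpha>) = Determinant.det (cmv_char n \<alpha>)"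
proof -
  have "char_poly_matrix (cmv_mat n \<alpha>) = cmv_char n \<alpha>"
    by (rule eq_matI) (auto simp: char_poly_matrix_def cmv_mat_def cmv_char_def)
  then show ?thesis by (simp add: char_poly_def)
qed

text \<open>
  Removing the first row and column swaps odd and even indices, and this amounts to a
  transposition.
\<close>

lemma cmv_entry_shift:
  assumes "1 \<le> i" "1 \<le> j"
  shows "cmv_entry \<alpha> (Suc i) (Suc j) = cmv_entry (\<lambda>n. \<alpha> (Suc n)) j i"
  using assms by (auto simp: cmv_entry_def cmv_rho_def)

lemma det_cmv_char_Suc:
  "Determinant.det (cmv_char (Suc n) \<alpha>) =
     pCons 0 (Determinant.det (cmv_char n (\<lambda>i. \<alpha> (Suc i))))
     + smult (\<alpha> 0) (Determinant.det (cmv_row_char (Suc n) \<alpha>))"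
proof -
  let ?A = "cmv_char (Suc n) \<alpha>" and ?B = "cmv_row_char (Suc n) \<alpha>"
  have row: "?A $$ (0, j) = (if j = 0 then [:0, 1:] else 0) + [:\<alpha> 0:] * ?B $$ (0, j)"
    if "j < Suc n" for j
    using that by (auto simp: cmv_char_def cmv_row_char_def cmv_entry_def)
  have cof: "cofactor ?A 0 j = cofactor ?B 0 j" if "j < Suc n" for j
  proof -
    have "mat_delete ?A 0 j = mat_delete ?B 0 j"
      using that by (intro eq_matI) (auto simp: mat_delete_def cmv_char_def cmv_row_char_def)
    then show ?thesis by (simp add: cofactor_def)
  qed
  have del: "mat_delete ?A 0 0 = transpose_mat (cmv_char n (\<lambda>i. \<alpha> (Suc i)))"
    by (rule eq_matI) (auto simp: mat_delete_def cmv_char_def cmv_entry_shift)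
  have "Determinant.det ?A = (\<Sum>j<Suc n. ?A $$ (0, j) * cofactor ?A 0 j)"
    by (rule laplace_expansion_row) auto
  also have "\<dots> = (\<Sum>j<Suc n. (if j = 0 then [:0, 1:] * cofactor ?A 0 0 else 0)
      + [:\<alpha> 0:] * (?B $$ (0, j) * cofactor ?B 0 j))"
    by (intro sum.cong refl) (subst row, simp, subst cof, simp, simp add: algebra_simps cof[symmetric])
  also have "\<dots> = [:0, 1:] * cofactor ?A 0 0
      + [:\<alpha> 0:] * (\<Sum>j<Suc n. ?B $$ (0, j) * cofactor ?B 0 j)"
    unfolding sum.distrib sum_distrib_left by (simp only: sum.delta finite_lessThan lessThan_iff zero_less_Suc if_True)
  also have "(\<Sum>j<Suc n. ?B $$ (0, j) * cofactor ?B 0 j) = Determinant.det ?B"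
    by (rule laplace_expansion_row[symmetric]) auto
  also have "cofactor ?A 0 0 = Determinant.det (cmv_char n (\<lambda>i. \<alpha> (Suc i)))"
    by (simp add: cofactor_def del Determinant.det_transpose[of _ n])
  finally show ?thesis by simp
qed

text \<open>
  The first column of the second minor is \<open>-\<rho>\<^sub>1\<close> times the special row of the next smaller
  matrix; the two factors \<open>\<rho>\<^sub>1\<close> combine to \<open>1 - |\<alpha>\<^sub>1|\<^sup>2\<close>, which is what cancels the
  extra term in the expansion of the first minor.
\<close>

lemma det_cmv_row_char_Suc:
  assumes "cmod (\<alpha> 1) \<le> 1"
  shows "Determinant.det (cmv_row_char (Suc (Suc n)) \<alpha>) =
     Determinant.det (cmv_row_char (Suc n) (\<lambda>i. \<alpha> (Suc i)))
     + smult (cnj (\<alpha> 1)) (pCons 0 (Determinant.det (cmv_char n (\<lambda>i. \<alpha> (Suc (Suc i))))))"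
proof -
  let ?B = "cmv_row_char (Suc (Suc n)) \<alpha>"
  define \<gamma> where "\<gamma> = (\<lambda>i. \<alpha> (Suc i))"
  let ?D = "Determinant.det (cmv_row_char (Suc n) \<gamma>)"
  let ?\<rho> = "cmv_rho \<alpha> 1"
  have del0: "mat_delete ?B 0 0 = transpose_mat (cmv_char (Suc n) \<gamma>)"
    by (rule eq_matI) (auto simp: mat_delete_def cmv_row_char_def cmv_char_def cmv_entry_shift \<gamma>_def)
  have del1: "mat_delete ?B 0 1 = transpose_mat (multrow 0 [:- ?\<rho>:] (cmv_row_char (Suc n) \<gamma>))"
  proof (rule eq_matI)
    fix i j
    assume "i < dim_row (transpose_mat (multrow 0 [:- ?\<rho>:] (cmv_row_char (Suc n) \<gamma>)))"
      "j < dim_col (transpose_mat (multrow 0 [:- ?\<rho>:] (cmv_row_char (Suc n) \<gamma>)))"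
    then have ij: "i < Suc n" "j < Suc n" by (auto simp: cmv_row_char_def)
    show "mat_delete ?B 0 1 $$ (i, j)
        = transpose_mat (multrow 0 [:- ?\<rho>:] (cmv_row_char (Suc n) \<gamma>)) $$ (i, j)"
    proof (cases "j = 0")
      case True
      then show ?thesis
        using ij by (auto simp: mat_delete_def cmv_row_char_def cmv_char_def cmv_entry_def cmv_rho_def \<gamma>_def)
    next
      case False
      then show ?thesis
        using ij by (auto simp: mat_delete_def cmv_row_char_def cmv_char_def cmv_entry_shift \<gamma>_def)
    qed
  qed (auto simp: mat_delete_def cmv_row_char_def)
  have \<rho>2: "?\<rho> * ?\<rho> = 1 - \<alpha> 1 * cnj (\<alpha> 1)"
  proof -
    have "1 - (cmod (\<alpha> 1))\<^sup>2 \<ge> 0" using assms by (simp add: abs_square_le_1)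
    then have "?\<rho> * ?\<rho> = complex_of_real (1 - (cmod (\<alpha> 1))\<^sup>2)"
      unfolding cmv_rho_def of_real_mult[symmetric] by (simp only: real_sqrt_mult_self abs_of_nonneg)
    then show ?thesis by (simp add: complex_norm_square del: of_real_power)
  qed
  have "Determinant.det ?B = (\<Sum>j<Suc (Suc n). ?B $$ (0, j) * cofactor ?B 0 j)"
    by (rule laplace_expansion_row) auto
  also have "\<dots> = (\<Sum>j\<in>{0, 1}. ?B $$ (0, j) * cofactor ?B 0 j)"
    by (rule sum.mono_neutral_right) (auto simp: cmv_row_char_def)
  also have "\<dots> = [:cnj (\<alpha> 1):] * cofactor ?B 0 0 + [:?\<rho>:] * cofactor ?B 0 1"
    by (simp add: cmv_row_char_def)
  also have "cofactor ?B 0 0 = Determinant.det (cmv_char (Suc n) \<gamma>)"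
    by (simp add: cofactor_def del0 Determinant.det_transpose[of _ "Suc n"])
  also have "cofactor ?B 0 1 = [:?\<rho>:] * ?D"
    unfolding cofactor_def del1
    by (subst Determinant.det_transpose[of _ "Suc n"]) (auto simp: det_multrow[of _ "Suc n"])
  also have "[:cnj (\<alpha> 1):] * Determinant.det (cmv_char (Suc n) \<gamma>) + [:?\<rho>:] * ([:?\<rho>:] * ?D)
      = smult (cnj (\<alpha> 1)) (Determinant.det (cmv_char (Suc n) \<gamma>)) + smult (?\<rho> * ?\<rho>) ?D"
    by simp
  also have "\<dots> = ?D + smult (cnj (\<alpha> 1)) (pCons 0 (Determinant.det (cmv_char n (\<lambda>i. \<gamma> (Suc i)))))"
    unfolding \<rho>2 det_cmv_char_Suc
    by (simp add: \<gamma>_def smult_add_right smult_diff_left mult.commute)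
  finally show ?thesis by (simp only: \<gamma>_def)
qed

text \<open>
  The parameter \<open>\<alpha> 0\<close> enters neither determinant; the sequence is shifted by one so that both
  determinants refer to the same steps of the recursion.
\<close>

lemma szego_eq_det:
  assumes "\<And>i. i < n \<Longrightarrow> cmod (\<alpha> (Suc i)) \<le> 1"
  shows "szego (\<lambda>i. \<alpha> (Suc i)) n (1, [:cnj (\<alpha> (Suc n)):]) =
    (Determinant.det (cmv_char n (\<lambda>i. \<alpha> (Suc i))), Determinant.det (cmv_row_char (Suc n) \<alpha>))"
  using assms
proof (induction n arbitrary: \<alpha>)
  case 0
  have "Determinant.det (cmv_row_char (Suc 0) \<alpha>) = [:cnj (\<alpha> 1):]"
    by (subst laplace_expansion_row[of _ "Suc 0" 0])
       (auto simp: cofactor_def cmv_row_char_def mat_delete_def det_dim_zero)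
  then show ?case by (simp add: det_dim_zero[of "cmv_char 0 _"])
next
  case (Suc n)
  have IH: "szego (\<lambda>i. \<alpha> (Suc (Suc i))) n (1, [:cnj (\<alpha> (Suc (Suc n))):]) =
      (Determinant.det (cmv_char n (\<lambda>i. \<alpha> (Suc (Suc i)))),
       Determinant.det (cmv_row_char (Suc n) (\<lambda>i. \<alpha> (Suc i))))"
    using Suc.prems by (intro Suc.IH) auto
  have "cmod (\<alpha> 1) \<le> 1" using Suc.prems[of 0] by simp
  then show ?case
    unfolding szego_Suc_outer IH det_cmv_char_Suc[of n "\<lambda>i. \<alpha> (Suc i)"]
    by (subst det_cmv_row_char_Suc) (simp_all add: szego_step_def)
qed

lemma char_poly_cmv_mat_eq_szegoF:
  assumes "\<And>j. j < n \<Longrightarrow> cmod (\<alpha> j) \<le> 1"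
  shows "char_poly (cmv_mat n \<alpha>) = szegoF \<alpha> n (cnj (\<alpha> n))"
  \<comment> \<open>Shifting back by one; the value inserted at index \<open>0\<close> is arbitrary.\<close>
  using szego_eq_det[of n "\<lambda>i. \<alpha> (i - 1)"] assms
  by (simp add: char_poly_cmv_mat szegoF_def)


section \<open>Truncated CMV matrices with prescribed eigenvalues\<close>

lemma card_le_order_if_rootpoly_dvd:
  assumes "rootpoly m z dvd p" "p \<noteq> 0"
  shows "card {j. j < m \<and> z j = w} \<le> order w p"
proof -
  have "[:- w, 1:] ^ card {j. j < m \<and> z j = w} = (\<Prod>i\<in>{j. j < m \<and> z j = w}. [:- z i, 1:])"
    by simp
  also have "\<dots> dvd rootpoly m z"
    unfolding rootpoly_def by (rule prod_dvd_prod_subset) auto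
  also note assms(1)
  finally show ?thesis using assms(2) by (simp add: order_divides)
qed

theorem theorem7p6:
  fixes m N :: nat and z \<alpha> :: "nat \<Rightarrow> complex"
  assumes "1 \<le> m" and "m \<le> N"
    and "\<forall>i\<in>{1..m}. cmod (z i) < 1"
    and "\<forall>n\<in>{m..<N}. cmod (\<alpha> n) < 1"
    and "cmod (\<alpha> N) = 1"
  shows "\<exists>(T :: complex mat) (\<beta> :: nat \<Rightarrow> complex).
           truncated_CMV N \<beta> T \<and>
           (\<forall>i\<in>{1..m}. eigenvalue T (z i) \<and>
              card {j \<in> {1..m}. z j = z i} \<le> alg_multiplicity T (z i)) \<and>
           (\<forall>n\<in>{m..N}. \<beta> n = \<alpha> n)"
proof -
  define x where "x = (\<lambda>i. z (Suc i))"
  define k where "k = N - m"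
  have N: "N = m + k" using assms(2) by (simp add: k_def)
  have "cmod (cnj (\<alpha> N)) = 1" "\<forall>i<m. cmod (x i) < 1" "\<forall>j<k. cmod (\<alpha> (m + j)) < 1"
    using assms(3-5) by (auto simp: x_def N)
  from prescribed_zeros[OF this] obtain b where b: "\<forall>j<m. cmod (b j) < 1"
      "\<forall>j<k. b (m + j) = \<alpha> (m + j)" "rootpoly m x dvd szegoF b N (cnj (\<alpha> N))"
    unfolding N by blast
  define \<beta> where "\<beta> = (\<lambda>n. if n < m then b n else \<alpha> n)"
  have b\<beta>: "b n = \<beta> n" if "n < N" for n
    using b(2)[rule_format, of "n - m"] that by (auto simp: \<beta>_def N)
  have \<beta>: "cmod (\<beta> n) < 1" if "n < N" for n
    using b(1) assms(4) that by (auto simp: \<beta>_def)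
  have \<beta>N: "\<beta> N = \<alpha> N" using assms(2) by (simp add: \<beta>_def)
  define T where "T = cmv_mat N \<beta>"
  have T: "T \<in> carrier_mat N N" by (simp add: T_def cmv_mat_def)
  have "char_poly T = szegoF \<beta> N (cnj (\<alpha> N))"
    unfolding T_def \<beta>N[symmetric] using \<beta> by (intro char_poly_cmv_mat_eq_szegoF less_imp_le)
  also have "\<dots> = szegoF b N (cnj (\<alpha> N))"
    unfolding szegoF_def by (subst szego_cong[of N b \<beta>]) (auto simp: b\<beta>)
  finally have dvd: "rootpoly m x dvd char_poly T" and nz: "char_poly T \<noteq> 0"
    using b(3) szegoF_neq_0 by auto
  have "eigenvalue T (z i) \<and> card {j \<in> {1..m}. z j = z i} \<le> alg_multiplicity T (z i)"
    if i: "i \<in> {1..m}" for i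
  proof
    have "poly (rootpoly m x) (z i) = 0"
      unfolding poly_rootpoly_eq_0 x_def using i by (intro exI[of _ "i - 1"]) auto
    then have "poly (char_poly T) (z i) = 0" using dvd by (auto elim!: dvdE)
    then show "eigenvalue T (z i)" using eigenvalue_root_char_poly[OF T] by simp
    have "{j \<in> {1..m}. z j = z i} = Suc ` {j. j < m \<and> x j = z i}"
      by (auto simp: x_def image_iff) (metis Suc_le_D Suc_le_eq One_nat_def)
    then have "card {j \<in> {1..m}. z j = z i} = card {j. j < m \<and> x j = z i}"
      by (simp add: card_image)
    then show "card {j \<in> {1..m}. z j = z i} \<le> alg_multiplicity T (z i)"
      using card_le_order_if_rootpoly_dvd[OF dvd nz] by (simp add: alg_multiplicity_def)
  qed
  moreover have "truncated_CMV N \<beta> T"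
    using \<beta> \<beta>N assms(5) by (simp add: truncated_CMV_def T_def)
  moreover have "\<forall>n\<in>{m..N}. \<beta> n = \<alpha> n" by (simp add: \<beta>_def)
  ultimately show ?thesis by blast
qed

end
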